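(* Suppose that $\Omega\subset\mathbb R^n$ is an open and convex set and that $\partial\Omega$ is piecewise smooth. Let $x_0\in\Omega$ and $\epsilon>0$ satisfy $\overline{B(x_0,\epsilon)}\subset\Omega$. Then there is $\rho\in C^\infty(\Omega)$ satisfying $\rho<0$ in $\Omega$, $|\nabla\rho|=1$ in $\Omega\setminus B(x_0,\epsilon)$, and $\partial_\nu\rho\le0$ on $\partial\Omega$.
   Context: $B(x_0,\epsilon)$ is the open Euclidean ball of radius $\epsilon$ centred at $x_0$. $\nu$ is the outward unit normal vector of $\partial\Omega$ (defined at the smooth points of the boundary), and $\partial_\nu\rho=\nu\cdot\nabla\rho$, where $\rho$ is understood to extend smoothly up to the boundary. *)

theory Defs
  imports "HOL-Analysis.Analysis"
begin

definition partial :: "'n \<Rightarrow> (real^'n::finite \<Rightarrow> real) \<Rightarrow> real^'n \<Rightarrow> real" where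
  "partial i f x = frechet_derivative f (at x) (axis i 1)"

definition grad :: "(real^'n::finite \<Rightarrow> real) \<Rightarrow> real^'n \<Rightarrow> real^'n" where
  "grad f x = (\<chi> i. partial i f x)"

lemma GDERIV_grad:
  fixes f :: "real^'n::finite \<Rightarrow> real"
  assumes "f differentiable at x"
  shows "GDERIV f x :> grad f x"
proof -
  let ?D = "frechet_derivative f (at x)"
  have D: "(f has_derivative ?D) (at x)"
    using assms by (simp add: frechet_derivative_works)
  have "?D h = h \<bullet> grad f x" for h
  proof -
    have "?D h = ?D (\<Sum>i\<in>UNIV. (h $ i) *\<^sub>R axis i 1)"
      using basis_expansion[of h] by (simp add: scalar_mult_eq_scaleR)
    also have "\<dots> = (\<Sum>i\<in>UNIV. (h $ i) *\<^sub>R ?D (axis i 1))"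
      using linear_frechet_derivative[OF assms] by (simp add: linear_sum linear_cmul)
    also have "\<dots> = h \<bullet> grad f x"
      by (simp add: inner_vec_def grad_def partial_def)
    finally show ?thesis .
  qed
  then have "?D = (\<lambda>h. h \<bullet> grad f x)" by blast
  with D show ?thesis unfolding gderiv_def by simp
qed

text \<open>The sets \<open>S\<close> below are meant to be open: only then do the values on \<open>S\<close> of the
  (two-sided) partial derivatives depend on \<open>f\<close> on \<open>S\<close> alone.\<close>

primrec Ck_on :: "nat \<Rightarrow> (real^'n::finite) set \<Rightarrow> (real^'n \<Rightarrow> real) \<Rightarrow> bool" where
  "Ck_on 0 S f \<longleftrightarrow> continuous_on S f"
| "Ck_on (Suc k) S f \<longleftrightarrow> (\<forall>x\<in>S. f differentiable at x) \<and> (\<forall>i. Ck_on k S (partial i f))"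

definition smooth_on :: "(real^'n::finite) set \<Rightarrow> (real^'n \<Rightarrow> real) \<Rightarrow> bool" where
  "smooth_on S f \<longleftrightarrow> (\<forall>k. Ck_on k S f)"

definition local_defining_function ::
    "(real^'n::finite) set \<Rightarrow> real^'n \<Rightarrow> (real^'n) set \<Rightarrow> (real^'n \<Rightarrow> real) \<Rightarrow> bool" where
  "local_defining_function \<Omega> x W \<phi> \<longleftrightarrow>
     open W \<and> x \<in> W \<and> smooth_on W \<phi> \<and> (\<forall>y\<in>W. grad \<phi> y \<noteq> 0) \<and>
     \<Omega> \<inter> W = {y\<in>W. \<phi> y < 0}"

definition smooth_boundary_points :: "(real^'n::finite) set \<Rightarrow> (real^'n) set" where
  "smooth_boundary_points \<Omega> = {x \<in> frontier \<Omega>. \<exists>W \<phi>. local_defining_function \<Omega> x W \<phi>}"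

text \<open>As a relation; the normal is the same for every choice of the local defining function.\<close>

definition outward_unit_normal :: "(real^'n::finite) set \<Rightarrow> real^'n \<Rightarrow> real^'n \<Rightarrow> bool" where
  "outward_unit_normal \<Omega> x \<nu> \<longleftrightarrow> x \<in> frontier \<Omega> \<and>
     (\<exists>W \<phi>. local_defining_function \<Omega> x W \<phi> \<and> \<nu> = grad \<phi> x /\<^sub>R norm (grad \<phi> x))"

text \<open>Vanishing \<open>(n - 1)\<close>-dimensional Hausdorff measure, \<open>n = CARD('n)\<close>. Imposing in addition an
  upper bound on the radii would not change the notion. The index set \<open>I\<close> may be empty, so that
  for \<open>n = 1\<close> (counting measure) exactly the empty set is null.\<close>

definition hypersurface_null :: "(real^'n::finite) set \<Rightarrow> bool" where
  "hypersurface_null N \<longleftrightarrow>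
     (\<forall>e>0. \<exists>(I :: nat set) c r. (\<forall>i\<in>I. 0 < r i) \<and> N \<subseteq> (\<Union>i\<in>I. ball (c i) (r i)) \<and>
        (\<lambda>i. r i ^ (CARD('n) - 1)) summable_on I \<and>
        (\<Sum>\<^sub>\<infinity>i\<in>I. r i ^ (CARD('n) - 1)) < (e::real))"

text \<open>The boundary is made up of the closures of disjoint, connected, relatively open smooth pieces,
  locally finite in number; what the open pieces leave out (edges, corners, cone tips) is null for
  the surface measure. For bounded \<open>\<Omega>\<close>, local finiteness means that there are finitely many
  pieces.\<close>

definition piecewise_smooth_boundary :: "(real^'n::finite) set \<Rightarrow> bool" where
  "piecewise_smooth_boundary \<Omega> \<longleftrightarrow>
     (\<exists>\<P>. (\<forall>P\<in>\<P>. connected P \<and> openin (top_of_set (frontier \<Omega>)) P \<and> P \<noteq> {} \<and>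
                P \<subseteq> smooth_boundary_points \<Omega>) \<and>
          pairwise disjnt \<P> \<and>
          locally_finite_in (top_of_set (frontier \<Omega>)) \<P> \<and>
          frontier \<Omega> = (\<Union>P\<in>\<P>. closure P) \<and>
          hypersurface_null (frontier \<Omega> - \<Union>\<P>))"

end

theory Submission
  imports Defs
begin

text \<open>The function \<open>x \<mapsto> -\<bar>x - x\<^sub>0\<bar>\<close> has all the required properties except smoothness at
  \<open>x\<^sub>0\<close>: the half-space bounded by the tangent plane at a smooth boundary point contains \<open>x\<^sub>0\<close> by
  convexity, so the normal derivative there is nonpositive. With \<open>q = \<bar>x - x\<^sub>0\<bar>\<^sup>2\<close> and the smooth
  function \<open>f s = exp (-1/s)\<close> for \<open>s > 0\<close>, \<open>f s = 0\<close> for \<open>s \<le> 0\<close>, the function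
  \<open>\<rho> = - sqrt (q + f (\<epsilon>\<^sup>2 - q))\<close> agrees with it outside the ball, and it is smooth since the
  radicand is positive everywhere.\<close>

section \<open>Calculus of \<open>C\<^sup>k\<close> functions\<close>

lemma partial_eq:
  assumes "(f has_derivative f') (at x)"
  shows "partial i f x = f' (axis i 1)"
  using frechet_derivative_at[OF assms] by (simp add: partial_def)

lemma grad_eq:
  assumes "GDERIV f x :> D"
  shows "grad f x = D"
  using assms by (simp add: gderiv_def grad_def partial_eq vec_eq_iff inner_axis')

lemma partial_cong_open:
  assumes "open S" "x \<in> S" "\<And>y. y \<in> S \<Longrightarrow> f y = g y" "f differentiable at x"
  shows "partial i f x = partial i g x"
  using frechet_derivative_transform_within_open[OF assms(4,1,2,3)] by (simp add: partial_def)

lemma differentiable_cong_open: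
  fixes f g :: "'a::real_normed_vector \<Rightarrow> 'b::real_normed_vector"
  assumes "open S" "x \<in> S" "\<And>y. y \<in> S \<Longrightarrow> f y = g y" "f differentiable at x"
  shows "g differentiable at x"
  using assms has_derivative_transform_within_open unfolding differentiable_def by metis

lemma Ck_on_cong:
  assumes "open S" "\<And>y. y \<in> S \<Longrightarrow> f y = g y" "Ck_on k S g"
  shows "Ck_on k S f"
  using assms(2,3)
proof (induction k arbitrary: f g)
  case 0
  then show ?case by (simp cong: continuous_on_cong)
next
  case (Suc k)
  note eq = Suc.prems(1)[symmetric]
  have "Ck_on k S (partial i f)" for i
  proof (rule Suc.IH)
    show "partial i f y = partial i g y" if "y \<in> S" for y
      using partial_cong_open[OF \<open>open S\<close> that eq] Suc.prems(2) that by simp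
  qed (use Suc.prems(2) in simp)
  then show ?case
    using Suc.prems(2) differentiable_cong_open[OF \<open>open S\<close> _ eq] by simp
qed

lemma Ck_on_Suc_imp_Ck_on: "Ck_on (Suc k) S f \<Longrightarrow> Ck_on k S f"
proof (induction k arbitrary: f)
  case 0
  then show ?case
    by (auto intro!: continuous_at_imp_continuous_on differentiable_imp_continuous_within)
next
  case (Suc k)
  then show ?case by auto
qed

lemma Ck_on_const: "Ck_on k S (\<lambda>x. c)"
proof (induction k arbitrary: c)
  case (Suc k)
  have "partial i (\<lambda>x::real^'a. c) = (\<lambda>x. 0)" for i
    by (rule ext) (simp add: partial_eq[OF has_derivative_const])
  with Suc show ?case by simp
qed simp

lemma Ck_on_add:
  assumes "open S" "Ck_on k S f" "Ck_on k S g"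
  shows "Ck_on k S (\<lambda>x. f x + g x)"
  using assms(2,3)
proof (induction k arbitrary: f g)
  case 0
  then show ?case by (simp add: continuous_on_add)
next
  case (Suc k)
  have "partial i (\<lambda>x. f x + g x) x = partial i f x + partial i g x" if "x \<in> S" for i x
  proof -
    have "(f has_derivative frechet_derivative f (at x)) (at x)"
      "(g has_derivative frechet_derivative g (at x)) (at x)"
      using Suc.prems that by (auto simp: frechet_derivative_works)
    from partial_eq[OF has_derivative_add[OF this]] show ?thesis
      by (simp add: partial_def)
  qed
  moreover have "Ck_on k S (\<lambda>x. partial i f x + partial i g x)" for i
    using Suc.prems by (intro Suc.IH) auto
  ultimately have "Ck_on k S (partial i (\<lambda>x. f x + g x))" for i
    by (rule Ck_on_cong[OF \<open>open S\<close>])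
  then show ?case using Suc.prems by simp
qed

lemma Ck_on_mult:
  assumes "open S" "Ck_on k S f" "Ck_on k S g"
  shows "Ck_on k S (\<lambda>x. f x * g x)"
  using assms(2,3)
proof (induction k arbitrary: f g)
  case 0
  then show ?case by (simp add: continuous_on_mult)
next
  case (Suc k)
  have "partial i (\<lambda>x. f x * g x) x = f x * partial i g x + partial i f x * g x"
    if "x \<in> S" for i x
  proof -
    have "(f has_derivative frechet_derivative f (at x)) (at x)"
      "(g has_derivative frechet_derivative g (at x)) (at x)"
      using Suc.prems that by (auto simp: frechet_derivative_works)
    from partial_eq[OF has_derivative_mult[OF this]] show ?thesis
      by (simp add: partial_def)
  qed
  moreover have "Ck_on k S (\<lambda>x. f x * partial i g x + partial i f x * g x)" for i
    using Suc.prems Suc.prems[THEN Ck_on_Suc_imp_Ck_on]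
    by (intro Ck_on_add \<open>open S\<close> Suc.IH) auto
  ultimately have "Ck_on k S (partial i (\<lambda>x. f x * g x))" for i
    by (rule Ck_on_cong[OF \<open>open S\<close>])
  then show ?case using Suc.prems by simp
qed

lemma Ck_on_compose_real:
  fixes F :: "nat \<Rightarrow> real \<Rightarrow> real"
  assumes "open S" "g ` S \<subseteq> T"
    and F: "\<And>j y. y \<in> T \<Longrightarrow> (F j has_real_derivative F (Suc j) y) (at y)"
    and "Ck_on k S g"
  shows "Ck_on k S (\<lambda>x. F j (g x))"
  using assms(4)
proof (induction k arbitrary: j)
  case 0
  have "continuous_on T (F j)"
    using F by (intro DERIV_continuous_on) (blast intro: has_field_derivative_at_within)
  with 0 \<open>g ` S \<subseteq> T\<close> show ?case
    by (auto intro: continuous_on_compose2)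
next
  case (Suc k)
  have D: "((\<lambda>x. F j (g x)) has_derivative
      (\<lambda>h. F (Suc j) (g x) * frechet_derivative g (at x) h)) (at x)"
    if "x \<in> S" for x
  proof -
    have "(g has_derivative frechet_derivative g (at x)) (at x)"
      using Suc.prems that by (auto simp: frechet_derivative_works)
    moreover have "(F j has_derivative (*) (F (Suc j) (g x))) (at (g x))"
      using F[of "g x" j] that \<open>g ` S \<subseteq> T\<close> by (auto simp: has_field_derivative_def)
    ultimately show ?thesis
      by (rule has_derivative_compose)
  qed
  have "partial i (\<lambda>x. F j (g x)) x = F (Suc j) (g x) * partial i g x"
    if "x \<in> S" for i x
    using partial_eq[OF D[OF that]] by (simp add: partial_def)
  moreover have "Ck_on k S (\<lambda>x. F (Suc j) (g x) * partial i g x)" for i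
    using Suc.IH[OF Ck_on_Suc_imp_Ck_on[OF Suc.prems]] Suc.prems
    by (intro Ck_on_mult \<open>open S\<close>) auto
  ultimately have "Ck_on k S (partial i (\<lambda>x. F j (g x)))" for i
    by (rule Ck_on_cong[OF \<open>open S\<close>])
  then show ?case
    using D by (auto simp: differentiable_def)
qed

lemma Ck_on_inner: "Ck_on k S (\<lambda>x. x \<bullet> a)"
proof (cases k)
  case 0
  then show ?thesis by (simp add: continuous_on_inner)
next
  case (Suc m)
  have D: "((\<lambda>x. x \<bullet> a) has_derivative (\<lambda>h. h \<bullet> a)) (at x)" for x :: "real^'a"
    by (auto intro!: derivative_eq_intros)
  have "partial i (\<lambda>x. x \<bullet> a) = (\<lambda>x. axis i 1 \<bullet> a)" for i
    by (rule ext) (simp add: partial_eq[OF D])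
  then show ?thesis
    using D Suc by (auto simp: differentiable_def Ck_on_const)
qed

lemma Ck_on_sum:
  assumes "open S" "\<And>i. i \<in> I \<Longrightarrow> Ck_on k S (f i)"
  shows "Ck_on k S (\<lambda>x. \<Sum>i\<in>I. f i x)"
  using assms(2)
  by (induction I rule: infinite_finite_induct) (simp_all add: Ck_on_const Ck_on_add \<open>open S\<close>)

lemma Ck_on_norm_diff_squared:
  assumes "open S"
  shows "Ck_on k S (\<lambda>x. (norm (x - x0))\<^sup>2)"
proof -
  have "(norm (x - x0))\<^sup>2
      = (\<Sum>i\<in>UNIV. (x \<bullet> axis i 1 + - x0 $ i) * (x \<bullet> axis i 1 + - x0 $ i))" for x
    by (simp add: power2_norm_eq_inner inner_vec_def[of "x - x0"] inner_axis)
  then show ?thesis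
    by (simp only:) (intro Ck_on_sum Ck_on_mult Ck_on_add Ck_on_inner Ck_on_const assms)
qed

section \<open>Powers and the flat function \<open>exp (-1/s)\<close>\<close>

lemma Ck_on_powr:
  assumes "open S" "Ck_on k S g" "\<And>x. x \<in> S \<Longrightarrow> g x > 0"
  shows "Ck_on k S (\<lambda>x. g x powr a)"
proof -
  define F where "F j y = (\<Prod>i<j. a - real i) * y powr (a - real j)" for j y
  have "(F j has_real_derivative F (Suc j) y) (at y)" if "y \<in> {0<..}" for j y
    unfolding F_def using that
    by (auto intro!: derivative_eq_intros simp: algebra_simps)
  from Ck_on_compose_real[of S g "{0<..}" F, OF assms(1) _ this assms(2), of 0] assms(3)
  show ?thesis by (auto simp: F_def)
qed

text \<open>The \<open>j\<close>-th derivative of \<open>exp (-1/s)\<close> is \<open>poly (flat_poly j) (1/s) * exp (-1/s)\<close>.\<close>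

primrec flat_poly :: "nat \<Rightarrow> real poly" where
  "flat_poly 0 = 1"
| "flat_poly (Suc j) = monom 1 2 * (flat_poly j - pderiv (flat_poly j))"

definition flat :: "nat \<Rightarrow> real \<Rightarrow> real" where
  "flat j s = (if s > 0 then poly (flat_poly j) (1 / s) * exp (- (1 / s)) else 0)"

lemma tendsto_poly_div_exp_0:
  fixes p :: "real poly"
  shows "((\<lambda>t. poly p t / exp t) \<longlongrightarrow> 0) at_top"
proof -
  have "poly p t / exp t = (\<Sum>i\<le>degree p. coeff p i * (t ^ i / exp t))" for t
    by (simp add: poly_altdef sum_divide_distrib)
  moreover have "((\<lambda>t. \<Sum>i\<le>degree p. coeff p i * (t ^ i / exp t)) \<longlongrightarrow> 0) at_top"
    by (intro tendsto_null_sum tendsto_mult_right_zero tendsto_power_div_exp_0)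
  ultimately show ?thesis by simp
qed

lemma flat_has_derivative: "(flat j has_real_derivative flat (Suc j) s) (at s)"
proof -
  consider "s < 0" | "s = 0" | "s > 0" by linarith
  then show ?thesis
  proof cases
    case 1
    then have "((\<lambda>s. 0) has_real_derivative flat (Suc j) s) (at s)"
      by (simp add: flat_def)
    then show ?thesis
      by (rule has_field_derivative_transform_within_open[where S = "{..<0}"])
        (use 1 in \<open>auto simp: flat_def\<close>)
  next
    case 3
    have "((\<lambda>s. poly (flat_poly j) (1 / s) * exp (- (1 / s))) has_real_derivative
        flat (Suc j) s) (at s)"
      unfolding flat_def using 3
      by (auto intro!: derivative_eq_intros
          simp: poly_monom field_simps power2_eq_square)
    then show ?thesis
      by (rule has_field_derivative_transform_within_open[where S = "{0<..}"])
        (use 3 in \<open>auto simp: flat_def\<close>)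
  next
    case 2
    have "((\<lambda>h. flat j h / h) \<longlongrightarrow> 0) (at_left 0)"
      by (rule tendsto_eventually) (auto simp: flat_def eventually_at_filter)
    moreover have "((\<lambda>h. flat j h / h) \<longlongrightarrow> 0) (at_right 0)"
    proof -
      have "((\<lambda>h. poly (pCons 0 (flat_poly j)) (inverse h) / exp (inverse h)) \<longlongrightarrow> 0)
          (at_right 0)"
        by (rule filterlim_compose[OF tendsto_poly_div_exp_0 filterlim_inverse_at_top_right])
      moreover have "\<forall>\<^sub>F h in at_right 0.
          poly (pCons 0 (flat_poly j)) (inverse h) / exp (inverse h) = flat j h / h"
        by (auto simp: eventually_at_filter flat_def exp_minus field_simps)
      ultimately show ?thesis
        by (rule Lim_transform_eventually)
    qed
    ultimately have "((\<lambda>h. flat j h / h) \<longlongrightarrow> 0) (at 0)"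
      by (rule filterlim_split_at)
    then show ?thesis
      using 2 by (simp add: has_field_derivative_iff flat_def)
  qed
qed

lemma Ck_on_flat:
  assumes "open S" "Ck_on k S g"
  shows "Ck_on k S (\<lambda>x. flat j (g x))"
  using Ck_on_compose_real[of S g UNIV flat] assms flat_has_derivative by blast

section \<open>The smoothed distance\<close>

lemma outward_unit_normal_inner_nonpos:
  fixes \<Omega> :: "(real^'n::finite) set"
  assumes "open \<Omega>" "convex \<Omega>" "outward_unit_normal \<Omega> x \<nu>" "y \<in> \<Omega>"
  shows "\<nu> \<bullet> (y - x) \<le> 0"
proof -
  obtain W \<phi> where x: "x \<in> frontier \<Omega>" and W: "open W" "x \<in> W" "smooth_on W \<phi>"
    and sub: "\<Omega> \<inter> W = {y\<in>W. \<phi> y < 0}" and \<nu>: "\<nu> = grad \<phi> x /\<^sub>R norm (grad \<phi> x)"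
    using assms(3) by (auto simp: outward_unit_normal_def local_defining_function_def)
  have "x \<notin> \<Omega>" "x \<in> closure \<Omega>"
    using x \<open>open \<Omega>\<close> by (auto simp: frontier_def interior_open)
  then have \<phi>x: "\<phi> x \<ge> 0"
    using sub W by force
  have "\<phi> differentiable at x"
    using W(2,3) by (auto simp: smooth_on_def dest: spec[of _ "Suc 0"])
  then have D: "(\<phi> has_derivative (\<lambda>h. h \<bullet> grad \<phi> x)) (at x)"
    using GDERIV_grad by (auto simp: gderiv_def)
  have "((\<lambda>t. \<phi> (x + t *\<^sub>R (y - x))) has_derivative (\<lambda>t. (t *\<^sub>R (y - x)) \<bullet> grad \<phi> x)) (at 0)"
    by (rule has_derivative_compose[of "\<lambda>t. x + t *\<^sub>R (y - x)"])
      (use D in \<open>auto intro!: derivative_eq_intros\<close>)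
  then have D': "((\<lambda>t. \<phi> (x + t *\<^sub>R (y - x))) has_real_derivative (y - x) \<bullet> grad \<phi> x) (at 0)"
    unfolding has_field_derivative_def
    by (rule has_derivative_eq_rhs) (simp add: fun_eq_iff mult.commute)
  have "(y - x) \<bullet> grad \<phi> x \<le> 0"
  proof (rule ccontr)
    assume "\<not> (y - x) \<bullet> grad \<phi> x \<le> 0"
    then obtain d where d: "d > 0"
      and inc: "\<And>t. 0 < t \<Longrightarrow> t < d \<Longrightarrow> \<phi> x < \<phi> (x + t *\<^sub>R (y - x))"
      using DERIV_pos_inc_right[OF D'] by auto
    have "((\<lambda>t. x + t *\<^sub>R (y - x)) \<longlongrightarrow> x + 0 *\<^sub>R (y - x)) (at_right 0)"
      by (intro tendsto_intros)
    then have "\<forall>\<^sub>F t in at_right 0. x + t *\<^sub>R (y - x) \<in> W"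
      by (rule topological_tendstoD) (use W in auto)
    moreover have "\<forall>\<^sub>F t in at_right 0. t \<in> {0<..<min d 1}"
      by (rule eventually_at_right_real) (use d in simp)
    ultimately have "\<forall>\<^sub>F t in at_right 0. x + t *\<^sub>R (y - x) \<in> W \<and> t \<in> {0<..<min d 1}"
      by (rule eventually_conj)
    from eventually_happens'[OF _ this]
    obtain t where t: "0 < t" "t < d" "t < 1" "x + t *\<^sub>R (y - x) \<in> W"
      by auto
    have "x - t *\<^sub>R (x - y) \<in> interior \<Omega>"
      using mem_interior_closure_convex_shrink[of \<Omega> y x t] t \<open>x \<in> closure \<Omega>\<close> assms
      by (simp add: interior_open)
    then have "x + t *\<^sub>R (y - x) \<in> \<Omega>"
      using \<open>open \<Omega>\<close> by (simp add: interior_open algebra_simps)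
    then have "\<phi> (x + t *\<^sub>R (y - x)) < 0"
      using sub t(4) by blast
    with inc[OF t(1,2)] \<phi>x show False by linarith
  qed
  then show ?thesis
    by (simp add: \<nu> inner_commute divide_nonpos_nonneg mult_le_0_iff)
qed

definition smoothed_dist :: "real \<Rightarrow> real^'n::finite \<Rightarrow> real^'n \<Rightarrow> real" where
  "smoothed_dist \<epsilon> x0 x = sqrt ((norm (x - x0))\<^sup>2 + flat 0 (\<epsilon>\<^sup>2 - (norm (x - x0))\<^sup>2))"

lemma smoothed_dist_radicand_pos:
  fixes x x0 :: "real^'n::finite"
  assumes "\<epsilon> > 0"
  shows "(norm (x - x0))\<^sup>2 + flat 0 (\<epsilon>\<^sup>2 - (norm (x - x0))\<^sup>2) > 0"
proof (cases "x = x0")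
  case False
  then show ?thesis by (simp add: flat_def add_pos_nonneg)
qed (use assms in \<open>simp add: flat_def\<close>)

lemma smooth_on_minus_smoothed_dist:
  assumes "\<epsilon> > 0" "open S"
  shows "smooth_on S (\<lambda>x. - smoothed_dist \<epsilon> x0 x)"
  unfolding smooth_on_def
proof
  fix k
  have "- smoothed_dist \<epsilon> x0 x =
      - 1 * ((norm (x - x0))\<^sup>2 + flat 0 (\<epsilon>\<^sup>2 + - 1 * (norm (x - x0))\<^sup>2)) powr (1 / 2)" for x
    using smoothed_dist_radicand_pos[OF \<open>\<epsilon> > 0\<close>, of x x0]
    by (simp add: smoothed_dist_def powr_half_sqrt)
  then show "Ck_on k S (\<lambda>x. - smoothed_dist \<epsilon> x0 x)"
    using smoothed_dist_radicand_pos[OF \<open>\<epsilon> > 0\<close>, of _ x0]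
    by (simp only:) (intro Ck_on_mult Ck_on_powr Ck_on_add Ck_on_flat Ck_on_const
        Ck_on_norm_diff_squared \<open>open S\<close>, simp)
qed

lemma grad_minus_smoothed_dist:
  fixes x x0 :: "real^'n::finite"
  assumes "\<epsilon> > 0" "x \<notin> ball x0 \<epsilon>"
  shows "grad (\<lambda>x. - smoothed_dist \<epsilon> x0 x) x = (x0 - x) /\<^sub>R norm (x0 - x)"
proof (rule grad_eq)
  have le: "\<epsilon> \<le> norm (x - x0)"
    using assms(2) by (simp add: dist_norm norm_minus_commute)
  then have pos: "norm (x - x0) > 0" and "\<epsilon>\<^sup>2 \<le> (norm (x - x0))\<^sup>2"
    using \<open>\<epsilon> > 0\<close> by (auto intro!: power_mono)
  then have flat0: "flat j (\<epsilon>\<^sup>2 - (norm (x - x0))\<^sup>2) = 0" for j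
    by (simp add: flat_def)
  have q: "((\<lambda>x. (norm (x - x0))\<^sup>2) has_derivative (\<lambda>h. 2 * (h \<bullet> (x - x0)))) (at x)"
    unfolding power2_norm_eq_inner
    by (auto intro!: derivative_eq_intros simp: inner_commute)
  have f: "((\<lambda>x. flat 0 (\<epsilon>\<^sup>2 - (norm (x - x0))\<^sup>2)) has_derivative (\<lambda>h. 0)) (at x)"
    by (rule has_derivative_eq_rhs,
        rule has_derivative_compose[OF has_derivative_diff[OF has_derivative_const q]
          flat_has_derivative[unfolded has_field_derivative_def]])
      (simp add: flat0)
  have "((\<lambda>x. sqrt ((norm (x - x0))\<^sup>2 + flat 0 (\<epsilon>\<^sup>2 - (norm (x - x0))\<^sup>2))) has_derivative
      (\<lambda>h. (2 * (h \<bullet> (x - x0)) + 0) * (inverse (norm (x - x0)) / 2))) (at x)"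
    by (rule has_derivative_eq_rhs,
        rule has_derivative_real_sqrt[OF smoothed_dist_radicand_pos[OF \<open>\<epsilon> > 0\<close>]
          has_derivative_add[OF q f]])
      (use pos in \<open>auto simp: flat0 field_simps\<close>)
  from has_derivative_minus[OF this]
  show "GDERIV (\<lambda>x. - smoothed_dist \<epsilon> x0 x) x :> (x0 - x) /\<^sub>R norm (x0 - x)"
    unfolding gderiv_def smoothed_dist_def
    by (rule has_derivative_eq_rhs)
      (auto simp: fun_eq_iff norm_minus_commute inner_diff_right algebra_simps)
qed

theorem lemma7:
  fixes \<Omega> :: "(real^'n::finite) set" and x0 :: "real^'n" and \<epsilon> :: real
  assumes "open \<Omega>" and "convex \<Omega>" and "piecewise_smooth_boundary \<Omega>"
    and "x0 \<in> \<Omega>" and "\<epsilon> > 0" and "closure (ball x0 \<epsilon>) \<subseteq> \<Omega>"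
  shows "\<exists>\<rho> :: real^'n \<Rightarrow> real.
           smooth_on \<Omega> \<rho> \<and>
           (\<forall>x\<in>\<Omega>. \<rho> x < 0) \<and>
           (\<forall>x\<in>\<Omega> - ball x0 \<epsilon>. norm (grad \<rho> x) = 1) \<and>
           (\<exists>U \<rho>'. open U \<and> closure \<Omega> \<subseteq> U \<and> smooth_on U \<rho>' \<and> (\<forall>x\<in>\<Omega>. \<rho>' x = \<rho> x) \<and>
              (\<forall>x\<in>frontier \<Omega>. \<forall>\<nu>. outward_unit_normal \<Omega> x \<nu> \<longrightarrow> \<nu> \<bullet> grad \<rho>' x \<le> 0))"
proof -
  let ?\<rho> = "\<lambda>x. - smoothed_dist \<epsilon> x0 x"
  have "?\<rho> x < 0" for x
    using smoothed_dist_radicand_pos[OF \<open>\<epsilon> > 0\<close>] by (simp add: smoothed_dist_def)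
  moreover have "norm (grad ?\<rho> x) = 1" if "x \<notin> ball x0 \<epsilon>" for x
  proof -
    have "x0 \<noteq> x"
      using that \<open>\<epsilon> > 0\<close> by auto
    then show ?thesis
      by (simp add: grad_minus_smoothed_dist[OF \<open>\<epsilon> > 0\<close> that])
  qed
  moreover have "\<nu> \<bullet> grad ?\<rho> x \<le> 0"
    if x: "x \<in> frontier \<Omega>" and \<nu>: "outward_unit_normal \<Omega> x \<nu>" for x \<nu>
  proof -
    have "x \<notin> \<Omega>"
      using x \<open>open \<Omega>\<close> by (simp add: frontier_def interior_open)
    then have "x \<notin> ball x0 \<epsilon>"
      using assms(6) closure_subset by blast
    then show ?thesis
      using outward_unit_normal_inner_nonpos[OF assms(1,2) \<nu> \<open>x0 \<in> \<Omega>\<close>] \<open>\<epsilon> > 0\<close>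
      by (simp add: grad_minus_smoothed_dist divide_nonpos_nonneg mult_le_0_iff)
  qed
  ultimately show ?thesis
    using smooth_on_minus_smoothed_dist[OF \<open>\<epsilon> > 0\<close>, of _ x0] \<open>open \<Omega>\<close>
    by (intro exI[of _ ?\<rho>] conjI exI[of _ UNIV]) auto
qed

end
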